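(* Let $G$ be a finite simple graph with no isolated vertices and minimum degree $\delta(G)$. (1) If $\delta(G)\ge2$, then $t(G)=t_e(G)$. (2) If $\delta(G)=1$ and no connected component of $G$ is a single edge, then $t_e(G)\le t(G)\le t_e(G)+1$. (3) If $\delta(G)=1$, then $t_e(G)\le t(G)\le t_e(G)+2$.
   Context: For a finite simple graph $G$, a family of subsets $B_v\subseteq[1,t]=\{1,\dots,t\}$, one for each vertex $v$, is a $G$-ECFF$(t,|V(G)|)$ if for every edge $\{a,b\}$ and every vertex $w\notin\{a,b\}$, $B_w\not\subseteq B_a\cup B_b$; it is a $G$-CFF$(t,|V(G)|)$ if in addition $B_a\not\subseteq B_b$ and $B_b\not\subseteq B_a$ for every edge $\{a,b\}$. $t_e(G)$ and $t(G)$ denote the minimum $t$ for which a $G$-ECFF$(t,|V(G)|)$, respectively a $G$-CFF$(t,|V(G)|)$, exists. *)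

theory Defs
  imports "Graph_Theory.Graph_Theory"
begin

text \<open>
  A finite simple graph is an instance of the locale \<^locale>\<open>graph\<close>: a finite, loop-free
  symmetric digraph without parallel arcs. An undirected edge \<open>{a, b}\<close> is the pair
  of opposite arcs \<open>(a, b)\<close> and \<open>(b, a)\<close>.
\<close>

definition is_ECFF :: "('a, 'b) pre_digraph \<Rightarrow> nat \<Rightarrow> ('a \<Rightarrow> nat set) \<Rightarrow> bool" where
  "is_ECFF G t B \<longleftrightarrow>
     (\<forall>v \<in> verts G. B v \<subseteq> {1..t}) \<and>
     (\<forall>a b. a \<rightarrow>\<^bsub>G\<^esub> b \<longrightarrow> (\<forall>w \<in> verts G - {a, b}. \<not> B w \<subseteq> B a \<union> B b))"

definition is_CFF :: "('a, 'b) pre_digraph \<Rightarrow> nat \<Rightarrow> ('a \<Rightarrow> nat set) \<Rightarrow> bool" where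
  "is_CFF G t B \<longleftrightarrow>
     is_ECFF G t B \<and> (\<forall>a b. a \<rightarrow>\<^bsub>G\<^esub> b \<longrightarrow> \<not> B a \<subseteq> B b \<and> \<not> B b \<subseteq> B a)"

definition t_ECFF :: "('a, 'b) pre_digraph \<Rightarrow> nat" where
  "t_ECFF G = (LEAST t. \<exists>B. is_ECFF G t B)"

definition t_CFF :: "('a, 'b) pre_digraph \<Rightarrow> nat" where
  "t_CFF G = (LEAST t. \<exists>B. is_CFF G t B)"

text \<open>
  Both minima are attained: singletons \<open>{1}, \<dots>, {n}\<close> give a CFF, hence an ECFF.
\<close>

lemma (in graph) ex_is_CFF: "\<exists>t B. is_CFF G t B"
proof -
  obtain f where f: "bij_betw f (verts G) {1..card (verts G)}"
    using ex_bij_betw_finite_nat[OF finite_verts] ex_bij_betw_nat_finite_1[OF finite_verts]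
      bij_betw_inv by blast
  have eq: "f x = f y \<longleftrightarrow> x = y" if "x \<in> verts G" "y \<in> verts G" for x y
    using f that by (auto simp: bij_betw_def inj_on_def)
  have edge: "a \<in> verts G \<and> b \<in> verts G \<and> a \<noteq> b" if "a \<rightarrow>\<^bsub>G\<^esub> b" for a b
    using that adj_in_verts adj_not_same by blast
  have "f v \<in> {1..card (verts G)}" if "v \<in> verts G" for v
    using f that by (auto simp: bij_betw_def)
  then have "is_CFF G (card (verts G)) (\<lambda>v. {f v})"
    unfolding is_CFF_def is_ECFF_def using edge eq by auto
  then show ?thesis by blast
qed

lemma (in graph) ex_is_ECFF: "\<exists>t B. is_ECFF G t B"
  using ex_is_CFF by (auto simp: is_CFF_def)

text \<open>
  In a \<^locale>\<open>graph\<close> the out-degree of a vertex (equal to its in-degree) is its number of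
  neighbours. The minimum is meaningful only when there is at least one vertex.
\<close>

definition min_degree :: "('a, 'b) pre_digraph \<Rightarrow> nat" where
  "min_degree G = Min (out_degree G ` verts G)"

end

theory Submission
  imports Defs
begin

text \<open>
  If \<open>a\<close> is adjacent to \<open>b\<close> and \<open>b\<close> has another neighbour \<open>c\<close>, then the ECFF condition for the
  edge \<open>{b, c}\<close> and the vertex \<open>a\<close> already gives that \<open>B a\<close> is not contained in \<open>B b\<close>. So an ECFF
  can only fail to be a CFF at an edge \<open>{a, b}\<close> with \<open>b\<close> a leaf. New points beyond \<open>t\<close>, added to
  any of the sets, do not destroy what holds on \<open>{1..t}\<close>, and they repair the leaves: one
  point given to every non-leaf suffices when no two leaves are adjacent, and two points suffice
  in general, the two ends of an isolated edge receiving different ones.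
\<close>

text \<open>Phrased through neighbours instead of \<open>out_degree\<close>, so that arcs have to be
  counted only when relating leaves to \<open>min_degree\<close>.\<close>

definition leaf :: "('a, 'b) pre_digraph \<Rightarrow> 'a \<Rightarrow> bool" where
  "leaf G v \<longleftrightarrow> (\<exists>!w. v \<rightarrow>\<^bsub>G\<^esub> w)"

context graph
begin

lemma adj_sym: "a \<rightarrow>\<^bsub>G\<^esub> b \<Longrightarrow> b \<rightarrow>\<^bsub>G\<^esub> a"
  using sym_arcs by (rule arcs_ends_symmetric)

lemma leaf_adj_unique: "leaf G v \<Longrightarrow> v \<rightarrow>\<^bsub>G\<^esub> a \<Longrightarrow> v \<rightarrow>\<^bsub>G\<^esub> b \<Longrightarrow> a = b"
  by (auto simp: leaf_def)

lemma t_ECFF_le_t_CFF: "t_ECFF G \<le> t_CFF G"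
proof -
  have "\<exists>B. is_CFF G (t_CFF G) B"
    unfolding t_CFF_def by (rule LeastI_ex[OF ex_is_CFF])
  then have "\<exists>B. is_ECFF G (t_CFF G) B"
    by (auto simp: is_CFF_def)
  then show ?thesis
    unfolding t_ECFF_def by (rule Least_le)
qed

lemma is_ECFF_not_subset:
  assumes B: "is_ECFF G t B" and ab: "a \<rightarrow>\<^bsub>G\<^esub> b" and "\<not> leaf G b"
  shows "\<not> B a \<subseteq> B b"
proof -
  have "b \<rightarrow>\<^bsub>G\<^esub> a" using ab by (rule adj_sym)
  with \<open>\<not> leaf G b\<close> obtain c where c: "b \<rightarrow>\<^bsub>G\<^esub> c" "c \<noteq> a"
    by (auto simp: leaf_def)
  have "a \<in> verts G - {b, c}"
    using ab c adj_in_verts adj_not_same by blast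
  with B c(1) have "\<not> B a \<subseteq> B b \<union> B c"
    unfolding is_ECFF_def by blast
  then show ?thesis by blast
qed

text \<open>Common core of the three upper bounds, used with \<open>k\<close> = 0, 1, 2:
  \<open>d v\<close> lists the new points given to \<open>v\<close>, numbered from 1 and then
  shifted past \<open>t\<close>.\<close>

lemma t_CFF_le_t_ECFF_add:
  assumes d: "\<And>v. d v \<subseteq> {1..k}"
    and leaves: "\<And>a b. a \<rightarrow>\<^bsub>G\<^esub> b \<Longrightarrow> leaf G b \<Longrightarrow> \<not> d a \<subseteq> d b"
  shows "t_CFF G \<le> t_ECFF G + k"
proof -
  define t where "t = t_ECFF G"
  have "\<exists>B. is_ECFF G t B"
    unfolding t_def t_ECFF_def by (rule LeastI_ex[OF ex_is_ECFF])
  then obtain B where B: "is_ECFF G t B" ..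
  define B' where "B' v = B v \<union> (+) t ` d v" for v
  have B_t: "B v \<subseteq> {1..t}" if "v \<in> verts G" for v
    using B that by (auto simp: is_ECFF_def)
  have old: "B' v \<inter> {1..t} = B v" if "v \<in> verts G" for v
    using B_t[OF that] d[of v] by (auto simp: B'_def)
  have new: "{i. 0 < i \<and> t + i \<in> B' v} = d v" if "v \<in> verts G" for v
    using B_t[OF that] d[of v] by (fastforce simp: B'_def)
  have "B' v \<subseteq> {1..t + k}" if "v \<in> verts G" for v
    using B_t[OF that] d[of v] by (fastforce simp: B'_def)
  moreover have "\<not> B' w \<subseteq> B' a \<union> B' b" if "a \<rightarrow>\<^bsub>G\<^esub> b" "w \<in> verts G - {a, b}" for a b w
  proof
    assume "B' w \<subseteq> B' a \<union> B' b"
    then have "B w \<subseteq> B a \<union> B b"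
      using old that adj_in_verts[OF that(1)] by blast
    with B that show False
      by (auto simp: is_ECFF_def)
  qed
  ultimately have "is_ECFF G (t + k) B'"
    by (auto simp: is_ECFF_def)
  moreover have not_subset: "\<not> B' a \<subseteq> B' b" if ab: "a \<rightarrow>\<^bsub>G\<^esub> b" for a b
  proof
    assume sub: "B' a \<subseteq> B' b"
    have V: "a \<in> verts G" "b \<in> verts G" using adj_in_verts[OF ab] by auto
    have "B a \<subseteq> B b" using sub old[OF V(1)] old[OF V(2)] by blast
    moreover have "d a \<subseteq> d b" using sub new[OF V(1)] new[OF V(2)] by blast
    ultimately show False
      using is_ECFF_not_subset[OF B ab] leaves[OF ab] by blast
  qed
  ultimately have "is_CFF G (t + k) B'"
    using adj_sym unfolding is_CFF_def by blast
  then show ?thesis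
    unfolding t_CFF_def t_def by (blast intro: Least_le)
qed

lemma min_degree_ge_2_not_leaf:
  assumes "min_degree G \<ge> 2"
  shows "\<not> leaf G v"
proof
  assume "leaf G v"
  then obtain w where w: "v \<rightarrow>\<^bsub>G\<^esub> w" and unique: "\<And>w'. v \<rightarrow>\<^bsub>G\<^esub> w' \<Longrightarrow> w' = w"
    by (auto simp: leaf_def)
  have "v \<in> verts G" using w adj_in_verts by blast
  then have "min_degree G \<le> out_degree G v"
    unfolding min_degree_def by (intro Min_le) auto
  \<comment> \<open>\<open>out_degree\<close> counts arcs; without parallel arcs,
    \<open>arc_to_ends\<close> is injective, so a single neighbour means at most one arc.\<close>
  moreover have "out_degree G v \<le> card {(v, w)}"
    unfolding out_degree_def
  proof (rule card_inj_on_le)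
    show "inj_on (arc_to_ends G) (out_arcs G v)"
      using inj_on_arc_to_ends by (rule inj_on_subset) auto
    show "arc_to_ends G ` out_arcs G v \<subseteq> {(v, w)}"
      using unique by (fastforce simp: arc_to_ends_def arcs_ends_conv)
  qed simp
  ultimately show False using assms by simp
qed

text \<open>Each of two adjacent leaves has only the other as neighbour, so no walk leaves the pair
  and it forms a whole component.\<close>

lemma adjacent_leaves_component:
  assumes ab: "a \<rightarrow>\<^bsub>G\<^esub> b" and "leaf G a" "leaf G b"
  shows "\<exists>H \<in> sccs. complete_digraph 2 H"
proof
  let ?S = "{a, b}"
  have ba: "b \<rightarrow>\<^bsub>G\<^esub> a" using ab by (rule adj_sym)
  have S: "?S \<subseteq> verts G" using adj_in_verts[OF ab] by auto
  have "a \<noteq> b" using ab adj_not_same by blast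
  have closed: "v \<in> ?S" if "u \<rightarrow>\<^sup>*\<^bsub>G\<^esub> v" "u \<in> ?S" for u v
    using that
  proof (induction rule: reachable_induct)
    case (step x y)
    then show ?case
      using leaf_adj_unique[OF \<open>leaf G a\<close> ab] leaf_adj_unique[OF \<open>leaf G b\<close> ba] by auto
  qed
  have "?S \<in> sccs_verts"
    unfolding sccs_verts_def using closed ab ba S by auto
  then show "G \<restriction> ?S \<in> sccs"
    by (simp add: sccs_conv_sccs_verts)
  have ind: "induced_subgraph (G \<restriction> ?S) G" using S by (rule induced_induce)
  have "digraph (G \<restriction> ?S)" using ind by (rule digraphI_induced)
  moreover have "symmetric (G \<restriction> ?S)" using sym_arcs ind by (rule induced_graph_imp_symmetric)
  ultimately have "graph (G \<restriction> ?S)" by (rule digraph.graphI)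
  moreover have "arcs_ends (G \<restriction> ?S) = {(u, v). (u, v) \<in> ?S \<times> ?S \<and> u \<noteq> v}"
    using ab ba \<open>a \<noteq> b\<close> no_loops by (force simp: arcs_ends_conv)
  ultimately show "complete_digraph 2 (G \<restriction> ?S)"
    using \<open>a \<noteq> b\<close> by (simp add: complete_digraph_def)
qed

lemma t_CFF_le_of_min_degree_ge_2:
  assumes "min_degree G \<ge> 2"
  shows "t_CFF G \<le> t_ECFF G"
  using t_CFF_le_t_ECFF_add[of "\<lambda>_. {}" 0] min_degree_ge_2_not_leaf[OF assms] by simp

lemma t_CFF_le_add_1:
  assumes "\<forall>H \<in> sccs. \<not> complete_digraph 2 H"
  shows "t_CFF G \<le> t_ECFF G + 1"
proof (rule t_CFF_le_t_ECFF_add)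
  let ?d = "\<lambda>v. if leaf G v then {} else {1::nat}"
  show "?d v \<subseteq> {1..1}" for v by simp
  \<comment> \<open>Two adjacent leaves would form a single-edge component, so \<open>a\<close> is
    no leaf and owns the point 1, which \<open>b\<close> lacks.\<close>
  show "\<not> ?d a \<subseteq> ?d b" if "a \<rightarrow>\<^bsub>G\<^esub> b" "leaf G b" for a b
    using that adjacent_leaves_component assms by auto
qed

lemma t_CFF_le_add_2: "t_CFF G \<le> t_ECFF G + 2"
proof -
  obtain f :: "'a \<Rightarrow> nat" where f: "inj_on f (verts G)"
    using finite_imp_inj_to_nat_seg[OF finite_verts] by blast
  \<comment> \<open>The injection \<open>f\<close> only serves to tell the two ends of an isolated edge apart.\<close>
  define P where "P v \<longleftrightarrow> leaf G v \<and> (\<forall>w. v \<rightarrow>\<^bsub>G\<^esub> w \<longrightarrow> leaf G w \<longrightarrow> f w < f v)" for v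
  let ?d = "\<lambda>v. if P v then {2} else {1::nat}"
  show ?thesis
  proof (rule t_CFF_le_t_ECFF_add)
    show "?d v \<subseteq> {1..2}" for v by simp
    show "\<not> ?d a \<subseteq> ?d b" if ab: "a \<rightarrow>\<^bsub>G\<^esub> b" and b: "leaf G b" for a b
    proof -
      have ba: "b \<rightarrow>\<^bsub>G\<^esub> a" using ab by (rule adj_sym)
      have "f a \<noteq> f b"
        using f adj_in_verts[OF ab] adj_not_same[of a] ab by (auto dest: inj_onD)
      moreover have "P b \<longleftrightarrow> (leaf G a \<longrightarrow> f a < f b)"
        unfolding P_def using b ba leaf_adj_unique[OF b ba] by blast
      moreover have "P a \<longleftrightarrow> leaf G a \<and> f b < f a"
        unfolding P_def using ab b leaf_adj_unique[of a b] by blast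
      \<comment> \<open>If \<open>a\<close> is a leaf, the larger value of \<open>f\<close> decides
        which end satisfies \<open>P\<close>; otherwise \<open>b\<close> alone does. So the ends
        receive {1} and {2}, which are incomparable.\<close>
      ultimately have "P a \<noteq> P b" by auto
      then show ?thesis by auto
    qed
  qed
qed

end

theorem theorem4p13:
  fixes G :: "('a, 'b) pre_digraph"
  assumes "graph G"
    and "verts G \<noteq> {}"
    and no_isolated: "\<forall>v \<in> verts G. \<exists>w. v \<rightarrow>\<^bsub>G\<^esub> w"
  shows "(min_degree G \<ge> 2 \<longrightarrow> t_CFF G = t_ECFF G) \<and>
    (min_degree G = 1 \<and> (\<forall>H \<in> pre_digraph.sccs G. \<not> complete_digraph 2 H) \<longrightarrow>
       t_ECFF G \<le> t_CFF G \<and> t_CFF G \<le> t_ECFF G + 1) \<and>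
    (min_degree G = 1 \<longrightarrow>
       t_ECFF G \<le> t_CFF G \<and> t_CFF G \<le> t_ECFF G + 2)"
proof -
  interpret graph G by fact
  show ?thesis
    using t_ECFF_le_t_CFF t_CFF_le_of_min_degree_ge_2 t_CFF_le_add_1 t_CFF_le_add_2
    by (simp add: le_antisym)
qed

end
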